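(* Let $G=SL(2,\mathbb{R})$, let $X\in\Omega$ and $h\in G$, and set $g=h\exp(iX)\in SL(2,\mathbb{C})$. Suppose that $g\in K_{\mathbb{C}}A_{\mathbb{C}}K_{\mathbb{C}}$. Then $$g\in K_{\mathbb{C}}\,A\,\exp\big(i\,\mathrm{conv}(\mathcal{W}X)\big)\,K_{\mathbb{C}}.$$
   Context: $G=SL(2,\mathbb{R})\subseteq G_{\mathbb{C}}=SL(2,\mathbb{C})$. $K_{\mathbb{C}}=SO(2,\mathbb{C})=\{k\in SL(2,\mathbb{C}): kk^t=\mathbf{1}\}$. $\mathfrak{a}=\{\mathrm{diag}(t,-t): t\in\mathbb{R}\}$, with $A=\exp(\mathfrak{a})=\{\mathrm{diag}(s,s^{-1}): s>0\}$ and $A_{\mathbb{C}}=\{\mathrm{diag}(z,z^{-1}): z\in\mathbb{C}^*\}$. The restricted roots are $\pm\alpha$ with $\alpha(\mathrm{diag}(t,-t))=2t$, and $\Omega=\{X\in\mathfrak{a}: |\alpha(X)|<\pi/2\}=\{\mathrm{diag}(t,-t): |t|<\pi/4\}$. The Weyl group $\mathcal{W}=\{\pm 1\}$ acts on $\mathfrak{a}$ by sign, and $\mathrm{conv}(\mathcal{W}X)=[-1,1]\cdot X$ is the convex hull of the Weyl group orbit of $X$. $\exp$ is the matrix exponential. *)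

theory Defs
  imports "HOL-Analysis.Analysis"
begin

text \<open>Matrices are \<open>complex ^ 2 ^ 2\<close> with the matrix product \<open>**\<close>. The type class operations
  \<open>*\<close>, \<open>1\<close> and \<open>^\<close> are entrywise on this type and are not used on matrices.\<close>

type_synonym cmat2 = "complex ^ 2 ^ 2"

definition diag2 :: "complex \<Rightarrow> complex \<Rightarrow> cmat2" where
  "diag2 a b = vector [vector [a, 0], vector [0, b]]"

definition cscale :: "complex \<Rightarrow> cmat2 \<Rightarrow> cmat2" where
  "cscale c M = (\<chi> i j. c * M $ i $ j)"

primrec matpow :: "cmat2 \<Rightarrow> nat \<Rightarrow> cmat2" where
  "matpow M 0 = mat 1"
| "matpow M (Suc n) = M ** matpow M n"

definition mexp :: "cmat2 \<Rightarrow> cmat2" where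
  "mexp M = (\<Sum>n. (1 / fact n) *\<^sub>R matpow M n)"

lemma diag2_nth [simp]:
  "diag2 a b $ 1 $ 1 = a" "diag2 a b $ 1 $ 2 = 0" "diag2 a b $ 2 $ 1 = 0" "diag2 a b $ 2 $ 2 = b"
  by (simp_all add: diag2_def)

lemma matpow_diag2: "matpow (diag2 a b) n = diag2 (a ^ n) (b ^ n)"
  by (induction n) (simp_all add: vec_eq_iff forall_2 matrix_matrix_mult_def sum_2 mat_def)

lemma mexp_diag2: "mexp (diag2 a b) = diag2 (exp a) (exp b)"
proof -
  have "(\<lambda>n. ((1 / fact n) *\<^sub>R matpow (diag2 a b) n) $ i $ j) sums (diag2 (exp a) (exp b) $ i $ j)"
    for i j
    using exp_converges[of a] exp_converges[of b] exhaust_2[of i] exhaust_2[of j]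
    by (elim disjE) (simp_all add: matpow_diag2 divide_inverse)
  then have "(\<lambda>n. (1 / fact n) *\<^sub>R matpow (diag2 a b) n) sums diag2 (exp a) (exp b)"
    unfolding sums_def
    by (intro vec_tendstoI) (simp only: sums_def sum_component)
  then show ?thesis
    by (simp add: mexp_def sums_iff)
qed

definition set_matmul :: "cmat2 set \<Rightarrow> cmat2 set \<Rightarrow> cmat2 set" (infixl "\<odot>" 70) where
  "S \<odot> T = {M ** N | M N. M \<in> S \<and> N \<in> T}"

definition SL2C :: "cmat2 set" where
  "SL2C = {g. det g = 1}"

definition SL2R :: "cmat2 set" where
  "SL2R = {g \<in> SL2C. \<forall>i j. g $ i $ j \<in> \<real>}"

definition K_C :: "cmat2 set" where
  "K_C = {k \<in> SL2C. k ** transpose k = mat 1}"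

definition A_C :: "cmat2 set" where
  "A_C = {diag2 z (inverse z) | z. z \<noteq> 0}"

definition \<aa> :: "cmat2 set" where
  "\<aa> = {diag2 (of_real t) (- of_real t) | t :: real. True}"

definition A_R :: "cmat2 set" where
  "A_R = mexp ` \<aa>"

lemma A_R_eq: "A_R = {diag2 (of_real s) (inverse (of_real s)) | s :: real. s > 0}"
proof -
  have exp_eq: "mexp (diag2 (of_real t) (- of_real t)) =
      diag2 (of_real (exp t)) (inverse (of_real (exp t)))" for t :: real
    unfolding mexp_diag2 exp_minus exp_of_real ..
  show ?thesis
  proof (intro equalityI subsetI)
    fix g assume "g \<in> A_R"
    then obtain t :: real where "g = mexp (diag2 (of_real t) (- of_real t))"
      unfolding A_R_def \<aa>_def by blast
    then show "g \<in> {diag2 (of_real s) (inverse (of_real s)) | s :: real. s > 0}"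
      using exp_eq [of t] exp_gt_zero [of t] by blast
  next
    fix g assume "g \<in> {diag2 (of_real s) (inverse (of_real s)) | s :: real. s > 0}"
    then obtain s :: real where "s > 0" and "g = diag2 (of_real s) (inverse (of_real s))"
      by blast
    then have "g = mexp (diag2 (of_real (ln s)) (- of_real (ln s)))"
      by (simp only: exp_eq exp_ln)
    then show "g \<in> A_R"
      unfolding A_R_def \<aa>_def by blast
  qed
qed

text \<open>The restricted root: \<open>\<alpha>(diag(t, -t)) = 2t\<close>. Only its values on \<open>\<aa>\<close> matter.\<close>

definition root_\<alpha> :: "cmat2 \<Rightarrow> real" where
  "root_\<alpha> X = 2 * Re (X $ 1 $ 1)"

definition \<Omega> :: "cmat2 set" where
  "\<Omega> = {X \<in> \<aa>. \<bar>root_\<alpha> X\<bar> < pi / 2}"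

text \<open>The Weyl group is \<open>{1, -1}\<close>, acting on \<open>\<aa>\<close> by sign.\<close>

definition weyl_orbit :: "cmat2 \<Rightarrow> cmat2 set" where
  "weyl_orbit X = (\<lambda>w. w *\<^sub>R X) ` {1, -1 :: real}"

lemma convex_hull_weyl_orbit: "convex hull (weyl_orbit X) = (\<lambda>c. c *\<^sub>R X) ` {-1..1 :: real}"
proof -
  have "convex hull {-1, 1 :: real} = {-1..1}"
    by (simp add: segment_convex_hull [symmetric] closed_segment_eq_real_ivl)
  then have "convex hull {1, -1 :: real} = {-1..1}"
    by (simp only: insert_commute)
  then show ?thesis
    unfolding weyl_orbit_def
    using convex_hull_linear_image [OF linear_scaleR_left [of X], of "{1, -1}"] by simp
qed

end

theory Submission
  imports Defs
begin

text \<open>If \<open>g = k\<^sub>1 diag(z, 1/z) k\<^sub>2\<close>, then \<open>z\<^sup>2 + z\<^sup>-\<^sup>2\<close> is the trace of \<open>g g\<^sup>T\<close>. For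
  \<open>g = h exp(iX)\<close> with \<open>X = diag(t, -t)\<close> that trace is \<open>a e\<^sup>2\<^sup>i\<^sup>t + b e\<^sup>-\<^sup>2\<^sup>i\<^sup>t\<close>, where \<open>a\<close>, \<open>b\<close> are
  the squared norms of the columns of \<open>h\<close>, so \<open>a b \<ge> det(h)\<^sup>2 = 1\<close>. Writing \<open>z\<^sup>2 = r e\<^sup>i\<^sup>\<phi>\<close>, the trace
  \<open>x + iy\<close> lies on the hyperbola \<open>(x / cos \<phi>)\<^sup>2 - (y / sin \<phi>)\<^sup>2 = 4\<close>, while \<open>a b \<ge> 1\<close> puts it on the
  convex side of the corresponding hyperbola for \<open>2t\<close>; confocality gives \<open>\<bar>\<phi>\<bar> \<le> 2\<bar>t\<bar>\<close>. The remaining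
  sign ambiguity of \<open>z\<close> is absorbed by \<open>-1 \<in> K\<^sub>\<complex>\<close>.\<close>

text \<open>If \<open>cos \<phi> < cos \<psi>\<close>, then \<open>re\<close> forces
  \<open>a + b < r + 1 / r\<close>, while \<open>im\<close> forces
  \<open>(r - 1 / r)\<^sup>2 \<le> (a - b)\<^sup>2\<close>. Subtracting squares turns these into
  \<open>4 * (a * b) < 4\<close>, against \<open>a * b \<ge> 1\<close>.\<close>

lemma confocal_hyperbolas_cos_le:
  fixes r a b \<phi> \<psi> :: real
  assumes r: "r > 0" and ab: "a * b \<ge> 1" "a > 0" "b > 0" and pos: "cos \<psi> > 0" "cos \<phi> > 0"
    and re: "(r + 1 / r) * cos \<phi> = (a + b) * cos \<psi>"
    and im: "(r - 1 / r) * sin \<phi> = (a - b) * sin \<psi>"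
  shows "cos \<psi> \<le> cos \<phi>"
proof (rule ccontr)
  assume "\<not> ?thesis"
  then have less: "cos \<phi> < cos \<psi>" by simp
  have "(a + b) * cos \<phi> < (r + 1 / r) * cos \<phi>"
    using less ab re by simp
  then have "a + b < r + 1 / r"
    using pos by simp
  then have P: "(a + b)\<^sup>2 < (r + 1 / r)\<^sup>2"
    using ab by (intro power_strict_mono) auto
  have "(cos \<phi>)\<^sup>2 < (cos \<psi>)\<^sup>2"
    using less pos by (intro power_strict_mono) auto
  then have sin_less: "(sin \<psi>)\<^sup>2 < (sin \<phi>)\<^sup>2"
    using sin_cos_squared_add[of \<phi>] sin_cos_squared_add[of \<psi>] by linarith
  have "(r - 1 / r)\<^sup>2 * (sin \<phi>)\<^sup>2 = (a - b)\<^sup>2 * (sin \<psi>)\<^sup>2"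
    using im by (metis power_mult_distrib)
  also have "\<dots> \<le> (a - b)\<^sup>2 * (sin \<phi>)\<^sup>2"
    using sin_less by (intro mult_left_mono) auto
  \<comment> \<open>By \<open>sin_less\<close> the factor \<open>(sin \<phi>)\<^sup>2\<close>
    exceeds a square, so it is positive and cancels.\<close>
  finally have Q: "(r - 1 / r)\<^sup>2 \<le> (a - b)\<^sup>2"
    using sin_less by (smt (verit) mult_le_cancel_right zero_le_power2)
  have "(r + 1 / r)\<^sup>2 - (r - 1 / r)\<^sup>2 = 4"
    using r by (simp add: power2_eq_square field_simps)
  moreover have "(a + b)\<^sup>2 - (a - b)\<^sup>2 = 4 * (a * b)"
    by (simp add: power2_eq_square algebra_simps)
  ultimately show False
    using P Q ab by linarith
qed

lemma abs_le_of_cos_le: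
  fixes x y :: real
  assumes "cos y \<le> cos x" "\<bar>x\<bar> \<le> pi" "\<bar>y\<bar> \<le> pi"
  shows "\<bar>x\<bar> \<le> \<bar>y\<bar>"
  using assms cos_mono_le_eq[of "\<bar>y\<bar>" "\<bar>x\<bar>"] by simp

lemma K_C_uminus:
  assumes "k \<in> K_C"
  shows "- k \<in> K_C"
  using assms
  by (simp add: K_C_def SL2C_def det_2 vec_eq_iff matrix_matrix_mult_def transpose_def)

text \<open>In \<open>g ** transpose g\<close> the factor \<open>k\<^sub>2\<close> cancels against
  its transpose; cyclicity of the trace then brings \<open>transpose k\<^sub>1\<close> next to
  \<open>k\<^sub>1\<close>, so only the diagonal part survives.\<close>

lemma trace_KAK:
  assumes "k\<^sub>1 \<in> K_C" "k\<^sub>2 \<in> K_C" and g: "g = k\<^sub>1 ** diag2 z (inverse z) ** k\<^sub>2"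
  shows "trace (g ** transpose g) = z\<^sup>2 + (inverse z)\<^sup>2"
proof -
  let ?D = "diag2 z (inverse z)"
  have k1: "transpose k\<^sub>1 ** k\<^sub>1 = mat 1" and k2: "k\<^sub>2 ** transpose k\<^sub>2 = mat 1"
    using assms matrix_left_right_inverse[of k\<^sub>1 "transpose k\<^sub>1"] by (auto simp: K_C_def)
  have "g ** transpose g = k\<^sub>1 ** ?D ** (k\<^sub>2 ** transpose k\<^sub>2) ** transpose ?D ** transpose k\<^sub>1"
    by (simp add: g matrix_transpose_mul matrix_mul_assoc)
  also have "\<dots> = k\<^sub>1 ** (?D ** transpose ?D ** transpose k\<^sub>1)"
    by (simp add: k2 matrix_mul_assoc)
  finally have "trace (g ** transpose g) = trace (?D ** transpose ?D ** transpose k\<^sub>1 ** k\<^sub>1)"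
    by (metis trace_mul_sym)
  also have "\<dots> = trace (?D ** transpose ?D ** (transpose k\<^sub>1 ** k\<^sub>1))"
    by (simp only: matrix_mul_assoc)
  also have "\<dots> = z\<^sup>2 + (inverse z)\<^sup>2"
    unfolding k1 matrix_mul_rid
    by (simp add: trace_def sum_2 matrix_matrix_mult_def transpose_def power2_eq_square)
  finally show ?thesis .
qed

lemma trace_real_times_diag:
  assumes "h \<in> SL2R"
  obtains a b :: real where "a > 0" "b > 0" "a * b \<ge> 1"
    "\<And>u v. trace ((h ** diag2 u v) ** transpose (h ** diag2 u v)) = of_real a * u\<^sup>2 + of_real b * v\<^sup>2"
proof -
  define H where "H i j = Re (h $ i $ j)" for i j
  have h: "h $ i $ j = of_real (H i j)" for i j
    using assms by (simp add: SL2R_def H_def)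
  have "complex_of_real (H 1 1 * H 2 2 - H 1 2 * H 2 1) = 1"
    using assms by (simp add: SL2R_def SL2C_def det_2 h)
  then have det: "H 1 1 * H 2 2 - H 1 2 * H 2 1 = 1"
    by (simp only: of_real_eq_1_iff)
  define a where "a = (H 1 1)\<^sup>2 + (H 2 1)\<^sup>2"
  define b where "b = (H 1 2)\<^sup>2 + (H 2 2)\<^sup>2"
  \<comment> \<open>Lagrange's identity: the second square is that of the inner product of the two
    columns.\<close>
  have "a * b = (H 1 1 * H 2 2 - H 1 2 * H 2 1)\<^sup>2 + (H 1 1 * H 1 2 + H 2 1 * H 2 2)\<^sup>2"
    by (simp add: a_def b_def power2_eq_square algebra_simps)
  then have ab: "a * b \<ge> 1"
    by (simp add: det)
  moreover have "a \<ge> 0" "b \<ge> 0"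
    by (simp_all add: a_def b_def)
  moreover have "a \<noteq> 0" "b \<noteq> 0"
    using ab by auto
  moreover have "trace ((h ** diag2 u v) ** transpose (h ** diag2 u v))
      = of_real a * u\<^sup>2 + of_real b * v\<^sup>2" for u v
    by (simp add: trace_def sum_2 matrix_matrix_mult_def transpose_def h a_def b_def
        power2_eq_square algebra_simps)
  ultimately show thesis
    using that[of a b] by simp
qed

lemma mexp_imaginary:
  "mexp (cscale \<i> (diag2 (of_real t) (- of_real t))) = diag2 (cis t) (cis (- t))"
proof -
  have "cscale \<i> (diag2 (of_real t) (- of_real t)) = diag2 (\<i> * of_real t) (\<i> * of_real (- t))"
    by (simp add: cscale_def vec_eq_iff forall_2)
  then show ?thesis
    by (simp only: mexp_diag2 cis_conv_exp)
qed

lemma Arg_square_bound: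
  fixes z :: complex and a b t :: real
  assumes z: "z \<noteq> 0" and ab: "a > 0" "b > 0" "a * b \<ge> 1" and t: "\<bar>t\<bar> < pi / 4"
    and eq: "z\<^sup>2 + (inverse z)\<^sup>2 = of_real a * (cis t)\<^sup>2 + of_real b * (cis (- t))\<^sup>2"
  shows "\<bar>Arg (z\<^sup>2)\<bar> \<le> 2 * \<bar>t\<bar>"
proof -
  define r where "r = cmod (z\<^sup>2)"
  define \<phi> where "\<phi> = Arg (z\<^sup>2)"
  have r: "r > 0" using z by (simp add: r_def)
  have polar: "z\<^sup>2 = of_real r * cis \<phi>"
    using rcis_cmod_Arg[of "z\<^sup>2"] by (simp add: r_def \<phi>_def rcis_def)
  have "(inverse z)\<^sup>2 = of_real (1 / r) * cis (- \<phi>)"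
    using polar by (simp add: power_inverse divide_inverse)
  with polar eq have eq': "of_real r * cis \<phi> + of_real (1 / r) * cis (- \<phi>)
      = of_real a * cis (2 * t) + of_real b * cis (- (2 * t))"
    by (simp add: Complex.DeMoivre)
  have re: "(r + 1 / r) * cos \<phi> = (a + b) * cos (2 * t)"
    using arg_cong[OF eq', of Re] by (simp add: algebra_simps)
  have im: "(r - 1 / r) * sin \<phi> = (a - b) * sin (2 * t)"
    using arg_cong[OF eq', of Im] by (simp add: algebra_simps)
  \<comment> \<open>The bound defining \<Omega> enters here: the right side of \<open>re\<close> is
    positive, which places \<phi> in the right half plane as well.\<close>
  have cos_pos: "cos (2 * t) > 0"
    using t by (intro cos_gt_zero_pi) auto
  then have "(r + 1 / r) * cos \<phi> > 0"
    using re ab by simp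
  moreover have "r + 1 / r > 0"
    using r by (simp add: add_pos_pos)
  ultimately have "cos \<phi> > 0"
    using zero_less_mult_pos by blast
  then have "cos (2 * t) \<le> cos \<phi>"
    using confocal_hyperbolas_cos_le r ab cos_pos re im by blast
  moreover have "\<bar>\<phi>\<bar> \<le> pi"
    using Arg_bounded[of "z\<^sup>2"] by (auto simp: \<phi>_def abs_le_iff)
  ultimately have "\<bar>\<phi>\<bar> \<le> \<bar>2 * t\<bar>"
    using t by (intro abs_le_of_cos_le) auto
  then show ?thesis by (simp add: \<phi>_def)
qed

theorem theorem4p1:
  fixes X h g :: cmat2
  assumes "X \<in> \<Omega>"
    and "h \<in> SL2R"
    and "g = h ** mexp (cscale \<i> X)"
    and "g \<in> K_C \<odot> A_C \<odot> K_C"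
  shows "g \<in> K_C \<odot> A_R \<odot> (\<lambda>Y. mexp (cscale \<i> Y)) ` (convex hull (weyl_orbit X)) \<odot> K_C"
proof -
  obtain t where X: "X = diag2 (of_real t) (- of_real t)" and t: "\<bar>t\<bar> < pi / 4"
    using assms(1) by (auto simp: \<Omega>_def \<aa>_def root_\<alpha>_def)
  obtain k\<^sub>1 z k\<^sub>2 where k: "k\<^sub>1 \<in> K_C" "k\<^sub>2 \<in> K_C" and z: "z \<noteq> 0"
    and g: "g = k\<^sub>1 ** diag2 z (inverse z) ** k\<^sub>2"
    using assms(4) by (auto simp: set_matmul_def A_C_def)
  obtain a b where ab: "a > 0" "b > 0" "a * b \<ge> 1"
    and tr: "\<And>u v. trace ((h ** diag2 u v) ** transpose (h ** diag2 u v))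
      = of_real a * u\<^sup>2 + of_real b * v\<^sup>2"
    using trace_real_times_diag[OF assms(2)] by metis
  have "z\<^sup>2 + (inverse z)\<^sup>2 = of_real a * (cis t)\<^sup>2 + of_real b * (cis (- t))\<^sup>2"
    using trace_KAK[OF k g] tr[of "cis t" "cis (- t)"] assms(3) by (simp only: X mexp_imaginary)
  then have bound: "\<bar>Arg (z\<^sup>2)\<bar> \<le> 2 * \<bar>t\<bar>"
    using Arg_square_bound z ab t by blast
  \<comment> \<open>Halving the principal argument of the square, instead of taking
    \<open>Arg z\<close>, keeps \<theta> within the bound; the price is that \<open>z\<close> is
    recovered only up to sign.\<close>
  define \<theta> where "\<theta> = Arg (z\<^sup>2) / 2"
  \<comment> \<open>For \<open>t = 0\<close> the quotient is 0 by convention, and \<theta> vanishes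
    too, so \<open>c * t = \<theta>\<close> still holds.\<close>
  define c where "c = \<theta> / t"
  have \<theta>: "\<bar>\<theta>\<bar> \<le> \<bar>t\<bar>" using bound by (simp add: \<theta>_def)
  then have ct: "c * t = \<theta>" and c: "c \<in> {-1..1}"
    by (auto simp: c_def divide_simps abs_le_iff abs_if split: if_splits)
  define s where "s = cmod z"
  have s: "s > 0" using z by (simp add: s_def)
  define w where "w = of_real s * cis \<theta>"
  have "w\<^sup>2 = z\<^sup>2"
    using rcis_cmod_Arg[of "z\<^sup>2"]
    by (simp add: w_def s_def \<theta>_def power_mult_distrib Complex.DeMoivre rcis_def norm_power)
  then have "z = w \<or> z = - w"
    by (auto simp: power2_eq_iff)
  then obtain k\<^sub>3 where k3: "k\<^sub>3 \<in> K_C" and g': "g = k\<^sub>1 ** diag2 w (inverse w) ** k\<^sub>3"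
  proof
    assume "z = - w"
    then have "g = k\<^sub>1 ** diag2 w (inverse w) ** (- k\<^sub>2)"
      by (simp add: g vec_eq_iff matrix_matrix_mult_def sum_2 forall_2)
    then show thesis using that K_C_uminus k by blast
  qed (use that g k in blast)
  \<comment> \<open>The modulus of \<open>w\<close> gives the factor in \<open>A_R\<close>, its
    phase the factor in the exponential of the convex hull.\<close>
  have split: "diag2 w (inverse w)
      = diag2 (of_real s) (inverse (of_real s)) ** diag2 (cis \<theta>) (cis (- \<theta>))"
    by (simp add: w_def vec_eq_iff matrix_matrix_mult_def sum_2 forall_2)
  have A: "diag2 (of_real s) (inverse (of_real s)) \<in> A_R"
    using s by (auto simp: A_R_eq)
  have "c *\<^sub>R X = diag2 (of_real \<theta>) (- of_real \<theta>)"
    unfolding ct[symmetric]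
    by (simp add: X vec_eq_iff forall_2) (simp add: scaleR_conv_of_real)
  then have "diag2 (cis \<theta>) (cis (- \<theta>)) = mexp (cscale \<i> (c *\<^sub>R X))"
    by (simp only: mexp_imaginary)
  then have E: "diag2 (cis \<theta>) (cis (- \<theta>))
      \<in> (\<lambda>Y. mexp (cscale \<i> Y)) ` (convex hull (weyl_orbit X))"
    using c by (simp only: convex_hull_weyl_orbit) (intro imageI)
  have "g = k\<^sub>1 ** diag2 (of_real s) (inverse (of_real s)) ** diag2 (cis \<theta>) (cis (- \<theta>)) ** k\<^sub>3"
    by (simp add: g' split matrix_mul_assoc)
  then show ?thesis
    using k(1) A E k3 unfolding set_matmul_def by blast
qed

end
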